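(* Let $\mathcal{H}$ be an infinite-dimensional separable real Hilbert space. The Polish group $\mathrm{Isom}(\mathcal{H})$ has dense conjugacy classes, i.e. there exists an element of $\mathrm{Isom}(\mathcal{H})$ whose conjugacy class is dense in $\mathrm{Isom}(\mathcal{H})$.
   Context: $\mathrm{Isom}(\mathcal{H})$ is the group of all isometries of $\mathcal{H}$ for the norm metric, endowed with the topology of pointwise convergence (the coarsest group topology making all orbit maps $g\mapsto gx$, $x\in\mathcal{H}$, continuous), which is Polish. *)

theory Defs
  imports "HOL-Analysis.Analysis" "HOL-Algebra.Group"
begin

definition isometry :: "('a::metric_space \<Rightarrow> 'b::metric_space) \<Rightarrow> bool"
  where "isometry f \<longleftrightarrow> bij f \<and> (\<forall>x y. dist (f x) (f y) = dist x y)"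

definition Isom :: "('a::metric_space \<Rightarrow> 'a) monoid"
  where "Isom = \<lparr>carrier = {g. isometry g}, mult = (\<lambda>g h. g \<circ> h), one = id\<rparr>"

lemma group_Isom: "group (Isom :: ('a::metric_space \<Rightarrow> 'a) monoid)"
proof (rule groupI)
  fix g :: "'a \<Rightarrow> 'a" assume "g \<in> carrier Isom"
  then have bij: "bij g" and dist: "\<And>x y. dist (g x) (g y) = dist x y"
    by (auto simp: Isom_def isometry_def)
  have "isometry (the_inv g)"
    unfolding isometry_def
    by (metis bij bij_betw_the_inv_into dist f_the_inv_into_f_bij_betw UNIV_I)
  moreover have "the_inv g \<circ> g = id"
    using bij by (auto simp: bij_def the_inv_f_f)
  ultimately show "\<exists>h\<in>carrier Isom. h \<otimes>\<^bsub>Isom\<^esub> g = \<one>\<^bsub>Isom\<^esub>"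
    by (auto simp: Isom_def)
qed (auto simp: Isom_def isometry_def bij_comp)

text \<open>
  The topology of pointwise convergence: a net \<open>g\<^sub>i\<close> converges to \<open>g\<close> iff \<open>g\<^sub>i x\<close> converges
  to \<open>g x\<close> in norm for every \<open>x\<close>. The two lemmas below say that it is the coarsest topology
  on the isometry group making all orbit maps continuous. Since it is already a group topology,
  it is also the coarsest group topology with this property.
\<close>

definition pointwise_topology :: "('a::metric_space \<Rightarrow> 'a) topology"
  where "pointwise_topology =
    subtopology (product_topology (\<lambda>_. euclidean) UNIV) (carrier Isom)"

lemma topspace_pointwise_topology [simp]: "topspace pointwise_topology = carrier Isom"
  by (simp add: pointwise_topology_def)

lemma continuous_map_orbit: "continuous_map pointwise_topology euclidean (\<lambda>g. g x)"
  unfolding pointwise_topology_def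
  by (intro continuous_map_from_subtopology continuous_map_product_projection) simp

lemma pointwise_topology_coarsest:
  assumes "topspace T = carrier Isom"
    and "\<And>x. continuous_map T euclidean (\<lambda>g. g x)"
  shows "continuous_map T pointwise_topology (\<lambda>g. g)"
  using assms unfolding pointwise_topology_def
  by (auto simp: continuous_map_in_subtopology continuous_map_componentwise_UNIV)

definition conjugacy_class :: "('g, 'm) monoid_scheme \<Rightarrow> 'g \<Rightarrow> 'g set"
  where "conjugacy_class G g = {h \<otimes>\<^bsub>G\<^esub> g \<otimes>\<^bsub>G\<^esub> inv\<^bsub>G\<^esub> h | h. h \<in> carrier G}"

end

(* It suffices to find one isometry g with the following property. For every isometry f and every
   finite set X there is a distance preserving map h on the union of X and f X, with g (h x) close
   to h (f x) for x in X. Reflections in bisecting hyperplanes extend h to an isometry of the whole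
   space, and then inv h \<circ> g \<circ> h is close to f on X.

   The element g is the inverse of a bilateral shift T of infinite multiplicity: there is a linear
   isometry J of the whole space such that the ranges of T^k J are mutually orthogonal. Write
   f x = A x + b with A orthogonal. The linear isometry V x = N^(-1/2) (\<Sum>k<N. T^k J A^k x)
   satisfies V x - T V A x = N^(-1/2) (J x - T^N J A^N x), which is small for large N. The
   translation part is absorbed by h x = V x + c with c - T c close to T V b; such c exists since
   the averages of T^m J w over m < M tend to 0. *)

theory Submission
  imports Defs
begin

section \<open>Distance preserving maps and reflections in real inner product spaces\<close>

lemma isometryI:
  assumes "\<And>x. g (f x) = x" "\<And>x. f (g x) = x" "\<And>x y. dist (f x) (f y) = dist x y"
  shows "isometry f"
  unfolding isometry_def using assms by (metis o_bij comp_def eq_id_iff)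

text \<open>Polarization turns preservation of distances into preservation of inner products. The
  squared norm of the defect of additivity or homogeneity then expands to the same expression in the
  arguments, which is 0. The map may fail to be onto; this matters for the embeddings built from
  orthonormal families below.\<close>

lemma dist_preserving_affine:
  fixes f :: "'a::real_inner \<Rightarrow> 'b::real_inner"
  assumes dist: "\<And>x y. dist (f x) (f y) = dist x y"
  shows "orthogonal_transformation (\<lambda>x. f x - f 0)"
proof -
  define A where "A x = f x - f 0" for x
  have nd: "norm (A x - A y) = norm (x - y)" for x y
    using dist[of x y] by (simp add: A_def dist_norm)
  have n: "norm (A x) = norm x" for x
    using nd[of x 0] by (simp add: A_def)
  have inner: "A x \<bullet> A y = x \<bullet> y" for x y
    using nd[of x y] n[of x] n[of y] by (simp add: dot_norm_neg)
  have "linear A"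
  proof (rule linearI)
    fix x y
    have "(norm (A (x + y) - (A x + A y)))\<^sup>2 = 0"
      unfolding power2_norm_eq_inner
      by (simp add: inner algebra_simps)
    then show "A (x + y) = A x + A y" by simp
  next
    fix r x
    have "(norm (A (r *\<^sub>R x) - r *\<^sub>R A x))\<^sup>2 = 0"
      unfolding power2_norm_eq_inner
      by (simp add: inner algebra_simps)
    then show "A (r *\<^sub>R x) = r *\<^sub>R A x" by simp
  qed
  with inner show ?thesis
    by (simp add: orthogonal_transformation_def A_def[abs_def])
qed

text \<open>The reflection in the hyperplane bisecting \<open>u\<close> and \<open>v\<close>, with
  normal \<open>w\<close> through the midpoint \<open>m\<close>. The points equidistant from
  \<open>u\<close> and \<open>v\<close> are those of the mirror.\<close>

lemma reflection_exists:
  fixes u v :: "'a::real_inner"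
  shows "\<exists>r. isometry r \<and> r u = v \<and> (\<forall>x. dist x u = dist x v \<longrightarrow> r x = x)"
proof (cases "u = v")
  case True
  then show ?thesis by (intro exI[of _ id]) (simp add: isometry_def bij_id[unfolded id_def] id_def)
next
  case False
  define w m where "w = u - v" and "m = (1/2) *\<^sub>R (u + v)"
  define r where "r x = x - (2 * ((x - m) \<bullet> w) / (w \<bullet> w)) *\<^sub>R w" for x
  have w: "w \<bullet> w \<noteq> 0" using False by (simp add: w_def)
  \<comment> \<open>The reflection reverses the component along the normal, so it is an involution,
    and this yields bijectivity.\<close>
  have neg: "(r x - m) \<bullet> w = - ((x - m) \<bullet> w)" for x
    using w by (simp add: r_def inner_diff_left)
  have rr: "r (r x) = x" for x
    unfolding r_def[of "r x"] neg by (simp add: r_def)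
  have "norm (r x - r y) = norm (x - y)" for x y
  proof -
    define z where "z = x - y"
    have eq: "r x - r y = z - (2 * (z \<bullet> w) / (w \<bullet> w)) *\<^sub>R w"
      by (simp add: r_def z_def inner_diff_left algebra_simps diff_divide_distrib)
    have "(r x - r y) \<bullet> (r x - r y) = z \<bullet> z"
      unfolding eq using w by (simp add: inner_diff_left inner_diff_right inner_commute field_simps)
    then show ?thesis by (simp add: norm_eq z_def)
  qed
  then have "isometry r"
    by (intro isometryI[of r]) (simp_all add: rr dist_norm)
  moreover have "r u = v"
  proof -
    have "(u - m) = (1/2) *\<^sub>R w"
      by (simp add: m_def w_def algebra_simps flip: scaleR_add_left)
    then have "2 * ((u - m) \<bullet> w) / (w \<bullet> w) = 1" using w by simp
    then have "r u = u - w" unfolding r_def by (simp only: scaleR_one)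
    then show ?thesis by (simp add: w_def)
  qed
  moreover have "r x = x" if "dist x u = dist x v" for x
  proof -
    have "(x - u) \<bullet> (x - u) = (x - v) \<bullet> (x - v)"
      using that by (simp add: dist_norm norm_eq)
    then have "(x - m) \<bullet> w = 0"
      by (simp add: m_def w_def inner_diff_left inner_diff_right inner_add_left inner_add_right
          inner_commute algebra_simps)
    then show ?thesis by (simp add: r_def)
  qed
  ultimately show ?thesis by blast
qed

text \<open>Points are matched one at a time. Once \<open>h\<close> agrees with \<phi> on
  \<open>S\<close>, reflecting \<open>h z\<close> to \<open>\<phi> z\<close> repairs the new point.
  Each earlier image \<open>\<phi> x\<close> is equidistant from \<open>h z\<close> and
  \<open>\<phi> z\<close>, hence lies on the mirror and stays fixed.\<close>

lemma isometry_extension_finite: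
  fixes \<phi> :: "'a::real_inner \<Rightarrow> 'a"
  assumes "finite S" "\<And>x y. x \<in> S \<Longrightarrow> y \<in> S \<Longrightarrow> dist (\<phi> x) (\<phi> y) = dist x y"
  shows "\<exists>h. isometry h \<and> (\<forall>x\<in>S. h x = \<phi> x)"
  using assms
proof (induction S rule: finite_induct)
  case empty
  show ?case by (intro exI[of _ id]) (simp add: isometry_def bij_id[unfolded id_def] id_def)
next
  case (insert z S)
  then obtain h where h: "isometry h" "\<And>x. x \<in> S \<Longrightarrow> h x = \<phi> x" by auto
  obtain r where r: "isometry r" "r (h z) = \<phi> z"
    "\<And>x. dist x (h z) = dist x (\<phi> z) \<Longrightarrow> r x = x"
    using reflection_exists by metis
  have "r (h x) = \<phi> x" if "x \<in> S" for x
  proof -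
    have "dist (\<phi> x) (h z) = dist (\<phi> x) (\<phi> z)"
      using h(1) h(2)[OF that] insert.prems[of x z] that by (simp add: isometry_def) metis
    then show ?thesis using r(3) h(2)[OF that] by simp
  qed
  moreover have "isometry (r \<circ> h)"
    using h(1) r(1) by (auto simp: isometry_def bij_comp)
  ultimately show ?case using r(2) by (metis comp_apply insert_iff)
qed

section \<open>Countable orthonormal bases\<close>

lemma orthonormal_expansion_inner:
  fixes B :: "'a::real_inner set"
  assumes "finite B" "pairwise orthogonal B" "\<And>b. b \<in> B \<Longrightarrow> norm b = 1" "b \<in> B"
  shows "(\<Sum>c\<in>B. (x \<bullet> c) *\<^sub>R c) \<bullet> b = x \<bullet> b"
proof -
  have "(\<Sum>c\<in>B. (x \<bullet> c) *\<^sub>R c) \<bullet> b = (\<Sum>c\<in>B. if c = b then x \<bullet> c else 0)"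
    unfolding inner_sum_left
  proof (intro sum.cong refl)
    fix c assume "c \<in> B"
    then show "((x \<bullet> c) *\<^sub>R c) \<bullet> b = (if c = b then x \<bullet> c else 0)"
      using assms by (auto simp: pairwise_def orthogonal_def norm_eq_1)
  qed
  then show ?thesis using assms by simp
qed

text \<open>One Gram-Schmidt step: the residual \<open>u\<close> of \<open>d\<close> after
  projection to the span of \<open>B\<close> either vanishes or is normalized and added.\<close>

lemma orthonormal_extend_finite:
  fixes d :: "'a::real_inner"
  assumes "finite B" "pairwise orthogonal B" "\<And>b. b \<in> B \<Longrightarrow> norm b = 1"
  shows "\<exists>C. finite C \<and> pairwise orthogonal C \<and> (\<forall>c\<in>C. norm c = 1) \<and> B \<subseteq> C \<and> d \<in> span C"
proof -
  define s where "s = (\<Sum>b\<in>B. (d \<bullet> b) *\<^sub>R b)"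
  define u where "u = d - s"
  have s: "s \<in> span B" unfolding s_def by (intro span_sum span_mul span_base)
  have orth: "orthogonal u b" if "b \<in> B" for b
    using orthonormal_expansion_inner[OF assms that, of d]
    by (simp add: u_def s_def orthogonal_def inner_diff_left)
  show ?thesis
  proof (cases "u = 0")
    case True
    then have "d \<in> span B" using s by (simp add: u_def)
    then show ?thesis using assms by blast
  next
    case False
    let ?C = "insert (u /\<^sub>R norm u) B"
    have "u /\<^sub>R norm u \<in> span ?C" by (intro span_base) simp
    then have "norm u *\<^sub>R (u /\<^sub>R norm u) + s \<in> span ?C"
      using s span_mono[of B ?C] by (meson span_add span_mul subset_insertI subsetD)
    then have "d \<in> span ?C" using False by (simp add: u_def)
    moreover have "pairwise orthogonal ?C"
      using assms(2) orth by (auto simp: pairwise_insert orthogonal_commute orthogonal_clauses)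
    moreover have "norm (u /\<^sub>R norm u) = 1" using False by simp
    ultimately show ?thesis using assms(1,3) by (intro exI[of _ ?C]) (auto simp del: norm_scaleR)
  qed
qed

text \<open>Gram-Schmidt along a dense sequence. A basis here means an orthonormal set with dense
  span.\<close>

lemma separable_orthonormal_basis:
  assumes "separable_space (euclidean :: 'a::real_inner topology)"
  shows "\<exists>B :: 'a set. countable B \<and> pairwise orthogonal B \<and> (\<forall>b\<in>B. norm b = 1) \<and> closure (span B) = UNIV"
proof -
  obtain D :: "'a set" where D: "countable D" "closure D = UNIV"
    using assms by (auto simp: separable_space_def)
  then have "D \<noteq> {}" by auto
  then obtain d :: "nat \<Rightarrow> 'a" where d: "range d = D"
    using D(1) range_from_nat_into by metis
  let ?P = "\<lambda>(n::nat) (B :: 'a set). finite B \<and> pairwise orthogonal B \<and> (\<forall>b\<in>B. norm b = (1::real))"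
  \<comment> \<open>The sets \<open>F n\<close> form an increasing chain of finite orthonormal sets,
    and \<open>d n\<close> is absorbed into the span at stage \<open>Suc n\<close>. Any two vectors
    of the union lie in a common stage.\<close>
  have "\<exists>F. \<forall>n::nat. ?P n (F n) \<and> (F n \<subseteq> F (Suc n) \<and> d n \<in> span (F (Suc n)))"
  proof (rule dependent_nat_choice)
    show "\<exists>B. ?P 0 B" by (intro exI[of _ "{}"]) simp
  next
    fix B n assume "?P n B"
    then show "\<exists>C. ?P (Suc n) C \<and> (B \<subseteq> C \<and> d n \<in> span C)"
      using orthonormal_extend_finite[of B "d n"] by auto
  qed
  then obtain F where F: "\<And>n. ?P n (F n)" "\<And>n. F n \<subseteq> F (Suc n)" "\<And>n. d n \<in> span (F (Suc n))"
    by auto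
  have mono: "F m \<subseteq> F n" if "m \<le> n" for m n
    using F(2) that by (rule lift_Suc_mono_le)
  let ?B = "\<Union>n. F n"
  have "countable ?B" using F(1) by (auto intro: countable_finite)
  moreover have "pairwise orthogonal ?B"
    unfolding pairwise_def
  proof (intro ballI impI)
    fix x y assume "x \<in> ?B" "y \<in> ?B" "x \<noteq> y"
    then obtain m n where "x \<in> F m" "y \<in> F n" by auto
    then have "x \<in> F (max m n)" "y \<in> F (max m n)"
      using mono[of m "max m n"] mono[of n "max m n"] by auto
    then show "orthogonal x y" using F(1) \<open>x \<noteq> y\<close> by (auto simp: pairwise_def)
  qed
  moreover have "D \<subseteq> span ?B"
    using F(3) span_mono[of "F _" ?B] d by fastforce
  then have "closure (span ?B) = UNIV"
    using D(2) closure_mono by blast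
  ultimately show ?thesis using F(1) by (intro exI[of _ ?B]) auto
qed

text \<open>The density principle used repeatedly below: a condition that cuts out a closed subspace
  holds everywhere once it holds on a set with dense span.\<close>

lemma eq_UNIV_of_closed_subspace:
  assumes "closed X" "subspace X" "B \<subseteq> X" "closure (span B) = UNIV"
  shows "X = UNIV"
  using assms by (metis closure_minimal span_minimal top.extremum_unique)

text \<open>If \<open>B\<close> were finite, the difference of \<open>x\<close> and its expansion
  \<open>s\<close> would be orthogonal to \<open>B\<close>, by density to every vector, and so to
  itself. Then \<open>B\<close> would span the whole space.\<close>

lemma orthonormal_basis_infinite:
  fixes B :: "'a::real_inner set"
  assumes "pairwise orthogonal B" "\<And>b. b \<in> B \<Longrightarrow> norm b = 1" "closure (span B) = UNIV"
    and "\<not> (\<exists>B :: 'a set. finite B \<and> span B = UNIV)"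
  shows "infinite B"
proof
  assume fin: "finite B"
  have "x \<in> span B" for x
  proof -
    define s where "s = (\<Sum>b\<in>B. (x \<bullet> b) *\<^sub>R b)"
    have "s \<bullet> b = x \<bullet> b" if "b \<in> B" for b
      unfolding s_def by (intro orthonormal_expansion_inner fin assms that)
    then have "B \<subseteq> {y. (x - s) \<bullet> y = 0}" by (auto simp: inner_diff_left)
    moreover have "closed {y. (x - s) \<bullet> y = 0}"
      by (intro closed_Collect_eq continuous_intros)
    moreover have "subspace {y. (x - s) \<bullet> y = 0}"
      by (simp add: subspace_def inner_add_right)
    ultimately have "{y. (x - s) \<bullet> y = 0} = UNIV"
      using assms(3) eq_UNIV_of_closed_subspace by metis
    then have "(x - s) \<bullet> (x - s) = 0" by blast
    then have "x = s" by simp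
    also have "s \<in> span B" unfolding s_def by (intro span_sum span_mul span_base)
    finally show ?thesis .
  qed
  then show False using fin assms(4) by blast
qed


section \<open>Linear isometries given by their values on an orthonormal basis\<close>

lemma orthogonal_transformation_continuous:
  assumes "orthogonal_transformation f"
  shows "continuous_on S f"
proof -
  have "bounded_linear f"
    using assms by (intro bounded_linear_intro[where K = 1])
      (auto simp: orthogonal_transformation linear_iff)
  then show ?thesis by (rule linear_continuous_on)
qed

text \<open>Orthonormal vectors are independent, so the assignment extends linearly to the span,
  where it preserves inner products. Completeness of the target extends it to the closure. The
  family \<open>e'\<close> may span a proper subspace, so \<open>U\<close> may be a non-surjective
  embedding.\<close>

lemma orthonormal_map_extends:
  fixes e :: "'i \<Rightarrow> 'a::real_inner" and e' :: "'i \<Rightarrow> 'b::{real_inner, complete_space}"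
  assumes e: "\<And>i j. e i \<bullet> e j = (if i = j then 1 else 0)"
    and e': "\<And>i j. e' i \<bullet> e' j = (if i = j then 1 else 0)"
    and dense: "closure (span (range e)) = UNIV"
  shows "\<exists>U. orthogonal_transformation U \<and> (\<forall>i. U (e i) = e' i)"
proof -
  have inj: "inj e"
    by (rule injI) (metis e zero_neq_one)
  have "pairwise orthogonal (range e)" "0 \<notin> range e"
    using e by (auto simp: pairwise_def orthogonal_def) (metis inner_zero_left zero_neq_one)
  then have "independent (range e)" by (rule pairwise_orthogonal_independent)
  then obtain \<phi> where \<phi>: "linear \<phi>" "\<And>x. x \<in> range e \<Longrightarrow> \<phi> x = e' (inv_into UNIV e x)"
    using linear_independent_extend[of "range e" "\<lambda>x. e' (inv_into UNIV e x)"] by blast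
  have \<phi>e: "\<phi> (e i) = e' i" for i using \<phi>(2)[of "e i"] inj by simp
  have 1: "\<phi> (e i) \<bullet> \<phi> y = e i \<bullet> y" if "y \<in> span (range e)" for i y
    using that
  proof (induction rule: span_induct)
    case base
    show ?case using \<phi>(1) by (simp add: subspace_def linear_iff linear_0 inner_add_right)
  next
    case (step y)
    then show ?case by (auto simp: \<phi>e e e')
  qed
  have 2: "\<phi> x \<bullet> \<phi> y = x \<bullet> y" if "x \<in> span (range e)" "y \<in> span (range e)" for x y
    using that(1)
  proof (induction rule: span_induct)
    case base
    show ?case using \<phi>(1) by (simp add: subspace_def linear_iff linear_0 inner_add_left)
  next
    case (step x)
    then show ?case using 1 that(2) by auto
  qed
  have dist: "dist (\<phi> x) (\<phi> y) = dist x y" if "x \<in> span (range e)" "y \<in> span (range e)" for x y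
  proof -
    have "dist (\<phi> x) (\<phi> y) = norm (\<phi> (x - y))"
      by (simp add: dist_norm linear_diff[OF \<phi>(1)])
    also have "\<dots> = norm (x - y)"
      using 2[of "x - y" "x - y"] that by (simp add: norm_eq span_diff)
    finally show ?thesis by (simp add: dist_norm)
  qed
  have "uniformly_continuous_on (span (range e)) \<phi>"
    unfolding uniformly_continuous_on_def using dist by auto
  then obtain g where "uniformly_continuous_on (closure (span (range e))) g"
    and g\<phi>: "\<And>x. x \<in> span (range e) \<Longrightarrow> \<phi> x = g x"
    using uniformly_continuous_on_extension_on_closure by metis
  then have g: "continuous_on UNIV g"
    using dense uniformly_continuous_imp_continuous by metis
  \<comment> \<open>The identity passes to limits in one variable at a time: first \<open>x\<close>
    becomes arbitrary with \<open>y\<close> in the span, then the roles are exchanged.\<close>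
  have gdist: "dist (g x) (g y) = dist x y" for x y
  proof -
    have closed: "closed {x. dist (g x) (g y) = dist x y}" for y
      by (intro closed_Collect_eq continuous_intros g)
    have *: "dist (g x) (g y) = dist x y" if y: "y \<in> span (range e)" for x y
    proof -
      have "span (range e) \<subseteq> {x. dist (g x) (g y) = dist x y}"
        using dist y g\<phi> by auto
      then show ?thesis using closure_minimal[OF _ closed] dense by blast
    qed
    have "span (range e) \<subseteq> {x. dist (g x) (g y) = dist x y}"
      using *[of _ y] by (auto simp: dist_commute)
    then show ?thesis using closure_minimal[OF _ closed] dense by blast
  qed
  have "g 0 = 0" using g\<phi>[of 0] linear_0[OF \<phi>(1)] by (simp add: span_zero)
  \<comment> \<open>Linearity of the extension comes from distance preservation together with
    \<open>g 0 = 0\<close>, not from a limit of the linear identities.\<close>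
  then have "orthogonal_transformation g"
    using dist_preserving_affine[of g, OF gdist] by simp
  moreover have "g (e i) = e' i" for i
    using g\<phi>[of "e i"] \<phi>e by (simp add: span_base)
  ultimately show ?thesis by blast
qed

lemma orthogonal_transformation_eqI:
  assumes "orthogonal_transformation f" "orthogonal_transformation g"
    and "closure (span B) = UNIV" "\<And>b. b \<in> B \<Longrightarrow> f b = g b"
  shows "f x = g x"
proof -
  have "closed {x. f x = g x}"
    by (intro closed_Collect_eq orthogonal_transformation_continuous assms)
  moreover have "subspace {x. f x = g x}"
    using assms(1,2) by (simp add: orthogonal_transformation_def linear_subspace_kernel
        subspace_def linear_iff linear_0)
  ultimately have "{x. f x = g x} = UNIV"
    using assms(3,4) eq_UNIV_of_closed_subspace[of "{x. f x = g x}" B] by blast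
  then show ?thesis by blast
qed

text \<open>The density principle applied twice, once in each argument.\<close>

lemma orthogonal_ranges:
  assumes P: "orthogonal_transformation P" and Q: "orthogonal_transformation Q"
    and dense: "closure (span B) = UNIV"
    and orth: "\<And>a b. a \<in> B \<Longrightarrow> b \<in> B \<Longrightarrow> orthogonal (P a) (Q b)"
  shows "orthogonal (P x) (Q y)"
proof -
  have cont: "continuous_on UNIV P" "continuous_on UNIV Q"
    using P Q by (auto intro: orthogonal_transformation_continuous)
  have lin: "linear P" "linear Q" using P Q by (auto simp: orthogonal_transformation_def)
  have *: "P a \<bullet> Q y = 0" if "a \<in> B" for a y
  proof -
    have "closed {y. P a \<bullet> Q y = 0}"
      by (intro closed_Collect_eq continuous_intros cont)
    moreover have "subspace {y. P a \<bullet> Q y = 0}"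
      using lin by (simp add: subspace_def linear_iff linear_0 inner_add_right)
    moreover have "B \<subseteq> {y. P a \<bullet> Q y = 0}"
      using orth that by (auto simp: orthogonal_def)
    ultimately show ?thesis using eq_UNIV_of_closed_subspace dense by blast
  qed
  have "closed {x. P x \<bullet> Q y = 0}"
    by (intro closed_Collect_eq continuous_intros cont)
  moreover have "subspace {x. P x \<bullet> Q y = 0}"
    using lin by (simp add: subspace_def linear_iff linear_0 inner_add_left)
  moreover have "B \<subseteq> {x. P x \<bullet> Q y = 0}" using * by auto
  ultimately show ?thesis
    unfolding orthogonal_def using eq_UNIV_of_closed_subspace dense by blast
qed

section \<open>The bilateral shift of infinite multiplicity\<close>

lemma orthogonal_transformation_funpow:
  fixes T :: "'a::real_inner \<Rightarrow> 'a"
  assumes "orthogonal_transformation T"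
  shows "orthogonal_transformation (T ^^ n)"
proof (induction n)
  case 0
  show ?case by (simp add: orthogonal_transformation linear_iff)
next
  case (Suc n)
  then show ?case using assms by (simp only: funpow.simps orthogonal_transformation_compose)
qed

text \<open>Index an orthonormal basis by \<open>int \<times> nat\<close> and think of the first
  index as the row. \<open>T\<close> moves every row up by one, and \<open>J\<close> embeds the
  whole space into row 0. Hence \<open>T ^^ k\<close> maps the range of \<open>J\<close> into row
  \<open>k\<close>, and distinct rows are orthogonal.\<close>

lemma wandering_shift_exists:
  assumes "separable_space (euclidean :: 'a::{real_inner, complete_space} topology)"
    and "\<not> (\<exists>B :: 'a set. finite B \<and> span B = UNIV)"
  shows "\<exists>(T :: 'a \<Rightarrow> 'a) (J :: 'a \<Rightarrow> 'a).
    bij T \<and> orthogonal_transformation T \<and> orthogonal_transformation J \<and>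
    (\<forall>i j x y. i \<noteq> j \<longrightarrow> orthogonal ((T ^^ i) (J x)) ((T ^^ j) (J y)))"
proof -
  obtain B :: "'a set" where B: "countable B" "pairwise orthogonal B" "\<And>b. b \<in> B \<Longrightarrow> norm b = 1"
    "closure (span B) = UNIV"
    using separable_orthonormal_basis[OF assms(1)] by blast
  have "infinite B" using orthonormal_basis_infinite[OF B(2-4) assms(2)] .
  then obtain \<beta> :: "'a \<Rightarrow> nat" where \<beta>: "bij_betw \<beta> B UNIV"
    using countableE_infinite B(1) by blast
  have "infinite (UNIV :: (int \<times> nat) set)" by (simp add: finite_prod)
  then obtain \<gamma> :: "int \<times> nat \<Rightarrow> nat" where \<gamma>: "bij \<gamma>"
    using countableE_infinite[of "UNIV :: (int \<times> nat) set"] by auto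
  \<comment> \<open>The bijection \<gamma> serves twice: here it helps to index the basis by pairs,
    and in the definition of \<open>J\<close> it lists all pairs along row 0.\<close>
  define e where "e = inv_into B \<beta> \<circ> \<gamma>"
  have e_bij: "bij_betw e UNIV B"
    unfolding e_def using bij_betw_trans[OF \<gamma> bij_betw_inv_into[OF \<beta>]] .
  then have range_e: "range e = B" and "inj e" by (auto simp: bij_betw_def)
  then have e: "e p \<bullet> e q = (if p = q then 1 else 0)" for p q
    using B(2) B(3)[of "e p"] injD[of e p q]
    by (cases "p = q") (auto simp: pairwise_def orthogonal_def norm_eq_1)
  have dense: "closure (span (range e)) = UNIV" using B(4) range_e by simp
  have ext: "\<exists>U. orthogonal_transformation U \<and> (\<forall>p. U (e p) = e (\<sigma> p))" if "inj \<sigma>" for \<sigma>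
    using that by (intro orthonormal_map_extends[OF e _ dense]) (auto simp: e inj_eq)
  have "inj (\<lambda>p :: int \<times> nat. (fst p + 1, snd p))" "inj (\<lambda>p :: int \<times> nat. (fst p - 1, snd p))"
    "inj (\<lambda>p. (0 :: int, \<gamma> p))"
    using \<gamma> by (auto simp: inj_def bij_def)
  from this[THEN ext] obtain T T' J
    where T: "orthogonal_transformation T" "\<And>p. T (e p) = e (fst p + 1, snd p)"
    and T': "orthogonal_transformation T'" "\<And>p. T' (e p) = e (fst p - 1, snd p)"
    and J: "orthogonal_transformation J" "\<And>p. J (e p) = e (0, \<gamma> p)"
    by blast
  have comp: "orthogonal_transformation (\<lambda>x. T (T' x))" "orthogonal_transformation (\<lambda>x. T' (T x))"
    using orthogonal_transformation_compose T(1) T'(1) by (auto simp: comp_def)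
  \<comment> \<open>The downward shift \<open>T'\<close> inverts \<open>T\<close>; rows are indexed
    by integers so that no row is lost.\<close>
  have "T (T' x) = x" for x
    by (rule orthogonal_transformation_eqI[OF comp(1) orthogonal_transformation_id dense])
       (auto simp: T(2) T'(2))
  moreover have "T' (T x) = x" for x
    by (rule orthogonal_transformation_eqI[OF comp(2) orthogonal_transformation_id dense])
       (auto simp: T(2) T'(2))
  ultimately have bij: "bij T" by (intro o_bij[of T' T]) auto
  have pow: "(T ^^ k) (J (e p)) = e (int k, \<gamma> p)" for k p
    by (induction k) (auto simp: T J add.commute)
  have "orthogonal ((T ^^ i) (J x)) ((T ^^ j) (J y))" if "i \<noteq> j" for i j x y
  proof -
    have comp: "orthogonal_transformation (\<lambda>x. (T ^^ i) (J x))" for i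
      using orthogonal_transformation_compose[OF orthogonal_transformation_funpow[OF T(1)] J(1)]
      by (simp only: comp_def)
    have "orthogonal ((T ^^ i) (J a)) ((T ^^ j) (J b))" if "a \<in> range e" "b \<in> range e" for a b
      using that \<open>i \<noteq> j\<close> by (auto simp: pow orthogonal_def e)
    then show ?thesis by (rule orthogonal_ranges[OF comp comp dense])
  qed
  then show ?thesis using bij T(1) J(1) by blast
qed

section \<open>Approximate coboundaries and intertwining for the shift\<close>

locale wandering_shift =
  fixes T J :: "'a::real_inner \<Rightarrow> 'a"
  assumes T: "orthogonal_transformation T" and J: "orthogonal_transformation J"
    and orth: "\<And>i j x y. i \<noteq> j \<Longrightarrow> orthogonal ((T ^^ i) (J x)) ((T ^^ j) (J y))"
begin

lemmas lin_T = orthogonal_transformation_linear[OF T]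
lemmas lin_J = orthogonal_transformation_linear[OF J]
lemmas lin_pow = orthogonal_transformation_linear[OF orthogonal_transformation_funpow[OF T]]

lemma norm_T [simp]: "norm (T x) = norm x"
  using T by (rule orthogonal_transformation_norm)

lemma norm_pow_J [simp]: "norm ((T ^^ k) (J x)) = norm x"
  using orthogonal_transformation_funpow[OF T] J by (metis orthogonal_transformation_norm)

text \<open>Pythagoras for summands in mutually orthogonal ranges. It makes the norm of a sum of
  \<open>M\<close> terms of equal size grow only like the square root of \<open>M\<close>, so
  averages tend to 0.\<close>

lemma norm_sum_pow_J:
  "(norm (\<Sum>k<N. (T ^^ k) (J (y k))))\<^sup>2 = (\<Sum>k<N. (norm (y k))\<^sup>2)"
  by (subst norm_sum_Pythagorean) (auto simp: pairwise_def orth)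

text \<open>The witness \<open>c\<close> is the average of the partial sums \<open>s m\<close> for
  \<open>m < M\<close>. Since \<open>s m - T (s m)\<close> telescopes to
  \<open>J w - (T ^^ m) (J w)\<close>, the error is an average of orthogonal vectors of norm
  \<open>norm w\<close>. Its norm is \<open>norm w / sqrt M\<close>, which the choice of
  \<open>M\<close> puts below \<epsilon>.\<close>

lemma almost_coboundary_J:
  assumes "\<epsilon> > 0"
  shows "\<exists>c. norm (c - T c - J w) < \<epsilon>"
proof -
  obtain M :: nat where M: "(norm w / \<epsilon>)\<^sup>2 < real M"
    using reals_Archimedean2 by blast
  then have M0: "M > 0" using zero_le_power2[of "norm w / \<epsilon>"] by (metis of_nat_0_less_iff order.strict_trans1)
  define s where "s m = (\<Sum>j<m. (T ^^ j) (J w))" for m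
  define c where "c = (1 / real M) *\<^sub>R (\<Sum>m<M. s m)"
  have s: "s m - T (s m) = J w - (T ^^ m) (J w)" for m
    using sum_lessThan_telescope'[of "\<lambda>j. (T ^^ j) (J w)" m]
    by (simp add: s_def linear_sum[OF lin_T] sum_subtractf)
  have "c - T c = (1 / real M) *\<^sub>R (\<Sum>m<M. s m - T (s m))"
    by (simp add: c_def linear_scale[OF lin_T] linear_sum[OF lin_T] sum_subtractf scaleR_diff_right)
  also have "\<dots> = J w - (1 / real M) *\<^sub>R (\<Sum>m<M. (T ^^ m) (J w))"
    using M0 by (simp add: s sum_subtractf scaleR_diff_right sum_constant_scaleR)
  finally have "norm (c - T c - J w) = norm (\<Sum>m<M. (T ^^ m) (J w)) / real M"
    by simp
  also have "\<dots> < \<epsilon>"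
  proof (rule power2_less_imp_less)
    show "(norm (\<Sum>m<M. (T ^^ m) (J w)) / real M)\<^sup>2 < \<epsilon>\<^sup>2"
      using M M0 assms unfolding power_divide norm_sum_pow_J
      by (simp add: field_simps power2_eq_square)
  qed (use assms in simp)
  finally show ?thesis by blast
qed

text \<open>Approximate solutions add up, with the error split in halves. A solution
  \<open>d\<close> for \<open>J (y N)\<close> gives the solution \<open>(T ^^ N) d\<close> for the
  term with exponent \<open>N\<close>, because \<open>T\<close> commutes with its powers and these
  preserve norms.\<close>

lemma almost_coboundary:
  assumes "\<epsilon> > 0"
  shows "\<exists>c. norm (c - T c - (\<Sum>k<N. (T ^^ k) (J (y k)))) < \<epsilon>"
  using assms
proof (induction N arbitrary: \<epsilon>)
  case 0
  then show ?case by (intro exI[of _ 0]) (simp add: linear_0[OF lin_T])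
next
  case (Suc N)
  obtain c where c: "norm (c - T c - (\<Sum>k<N. (T ^^ k) (J (y k)))) < \<epsilon> / 2"
    using Suc.IH[of "\<epsilon> / 2"] Suc.prems by auto
  obtain d where d: "norm (d - T d - J (y N)) < \<epsilon> / 2"
    using almost_coboundary_J[of "\<epsilon> / 2"] Suc.prems by auto
  let ?d = "(T ^^ N) d"
  have "?d - T ?d - (T ^^ N) (J (y N)) = (T ^^ N) (d - T d - J (y N))"
    by (simp add: linear_diff[OF lin_pow] funpow_swap1)
  then have "norm (?d - T ?d - (T ^^ N) (J (y N))) < \<epsilon> / 2"
    using d orthogonal_transformation_norm[OF orthogonal_transformation_funpow[OF T]] by simp
  moreover have "c + ?d - T (c + ?d) - (\<Sum>k<Suc N. (T ^^ k) (J (y k))) =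
      (c - T c - (\<Sum>k<N. (T ^^ k) (J (y k)))) + (?d - T ?d - (T ^^ N) (J (y N)))"
    by (simp add: linear_add[OF lin_T] algebra_simps)
  ultimately show ?case
    using c norm_triangle_lt[of "c - T c - (\<Sum>k<N. (T ^^ k) (J (y k)))"
        "?d - T ?d - (T ^^ N) (J (y N))" \<epsilon>]
    by (metis add_strict_mono field_sum_of_halves)
qed

text \<open>The natural candidate \<phi> preserves distances but need not be onto. The claim
  involves \<open>h\<close> only on \<open>X\<close> and its image under \<open>f\<close>, so
  agreeing with \<phi> on this finite set is enough.\<close>

lemma almost_intertwining:
  fixes f :: "'a \<Rightarrow> 'a"
  assumes f: "\<And>x y. dist (f x) (f y) = dist x y" and X: "finite X" and \<epsilon>: "\<epsilon> > 0"
  shows "\<exists>h. isometry h \<and> (\<forall>x\<in>X. dist (h x) (T (h (f x))) < \<epsilon>)"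
proof -
  define A where "A x = f x - f 0" for x
  have A: "orthogonal_transformation A"
    unfolding A_def[abs_def] using f by (rule dist_preserving_affine)
  have Apow: "linear (A ^^ k)" "norm ((A ^^ k) x) = norm x" for k x
    using orthogonal_transformation_funpow[OF A] by (auto simp: orthogonal_transformation)
  obtain K where K: "K > 0" "\<And>x. x \<in> X \<Longrightarrow> norm x \<le> K"
    using finite_imp_bounded[OF X] by (auto simp: bounded_pos)
  \<comment> \<open>With this \<open>N\<close> the two end terms left after telescoping, each of
    norm at most \<open>K / sqrt N\<close> on \<open>X\<close>, add up to less than
    \<open>\<epsilon> / 2\<close>.\<close>
  obtain N :: nat where N: "(4 * K / \<epsilon>)\<^sup>2 < real N"
    using reals_Archimedean2 by blast
  then have N0: "N > 0"
    using zero_le_power2[of "4 * K / \<epsilon>"] by (metis of_nat_0_less_iff order.strict_trans1)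
  define r where "r = 1 / sqrt (real N)"
  have r: "r > 0" "r\<^sup>2 * real N = 1" using N0 by (auto simp: r_def power_divide)
  have rK: "r * (4 * K) < \<epsilon>"
  proof -
    have "4 * K / \<epsilon> < sqrt (real N)" using N by (rule real_less_rsqrt)
    then show ?thesis using N0 \<epsilon> by (simp add: r_def field_simps)
  qed
  define V where "V x = (\<Sum>k<N. (T ^^ k) (J (r *\<^sub>R (A ^^ k) x)))" for x
  \<comment> \<open>By Pythagoras this is a sum of \<open>N\<close> equal terms, and
    \<open>r\<close> was chosen with \<open>r\<^sup>2 * real N = 1\<close>.\<close>
  have "(norm (V x))\<^sup>2 = (norm x)\<^sup>2" for x
    using r by (simp add: V_def norm_sum_pow_J Apow power_mult_distrib mult_ac)
  then have normV: "norm (V x) = norm x" for x by (simp add: power2_eq_iff_nonneg)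
  have linV: "linear V"
    by (rule linearI) (simp_all add: V_def linear_add[OF Apow(1)] linear_scale[OF Apow(1)]
        linear_add[OF lin_J] linear_scale[OF lin_J] linear_add[OF lin_pow] linear_scale[OF lin_pow]
        scaleR_add_right sum.distrib scaleR_sum_right mult_ac)
  have VA: "norm (V x - T (V (A x))) < \<epsilon> / 2" if "x \<in> X" for x
  proof -
    \<comment> \<open>Replacing \<open>x\<close> by \<open>A x\<close> and applying \<open>T\<close>
      raises both exponents by one, so only the first and the last term survive.\<close>
    have "V x - T (V (A x)) = J (r *\<^sub>R x) - (T ^^ N) (J (r *\<^sub>R (A ^^ N) x))"
      using sum_lessThan_telescope'[of "\<lambda>k. (T ^^ k) (J (r *\<^sub>R (A ^^ k) x))" N]
      by (simp add: V_def linear_sum[OF lin_T] sum_subtractf funpow_swap1)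
    also have "norm \<dots> \<le> norm (J (r *\<^sub>R x)) + norm ((T ^^ N) (J (r *\<^sub>R (A ^^ N) x)))"
      by (rule norm_triangle_ineq4)
    also have "\<dots> = r * (2 * norm x)"
      using r(1) Apow(2) orthogonal_transformation_norm[OF J] by simp
    also have "\<dots> \<le> r * (2 * K)" using K(2)[OF that] r(1) by simp
    also have "\<dots> < \<epsilon> / 2" using rK by simp
    finally show ?thesis .
  qed
  \<comment> \<open>The translation must satisfy \<open>c - T c\<close> close to
    \<open>T (V (f 0))\<close>. The sum \<open>V (f 0)\<close> has the form treated by
    \<open>almost_coboundary\<close>, so \<open>d\<close> is found for it first, and applying
    \<open>T\<close> gives the translation \<open>T d\<close>.\<close>
  obtain d where "norm (d - T d - V (f 0)) < \<epsilon> / 2"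
    using almost_coboundary[of "\<epsilon> / 2" "\<lambda>k. r *\<^sub>R (A ^^ k) (f 0)" N] \<epsilon> unfolding V_def by auto
  then have "norm (T (d - T d - V (f 0))) < \<epsilon> / 2" by simp
  then have c: "norm (T d - T (T d) - T (V (f 0))) < \<epsilon> / 2"
    by (simp add: linear_diff[OF lin_T])
  define \<phi> where "\<phi> x = V x + T d" for x
  have "dist (\<phi> x) (\<phi> y) = dist x y" for x y
    using normV[of "x - y"] by (simp add: \<phi>_def dist_norm linear_diff[OF linV])
  then obtain h where h: "isometry h" "\<And>x. x \<in> X \<union> f ` X \<Longrightarrow> h x = \<phi> x"
    using isometry_extension_finite[of "X \<union> f ` X" \<phi>] X by blast
  have "dist (h x) (T (h (f x))) < \<epsilon>" if "x \<in> X" for x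
  proof -
    have "V (f x) = V (A x) + V (f 0)"
      by (simp add: A_def flip: linear_add[OF linV])
    then have "h x - T (h (f x)) = (V x - T (V (A x))) + (T d - T (T d) - T (V (f 0)))"
      using that by (simp add: h(2) \<phi>_def linear_add[OF lin_T])
    also have "norm \<dots> < \<epsilon>"
      using VA[OF that] c by (intro norm_triangle_lt) simp
    finally show ?thesis by (simp add: dist_norm)
  qed
  with h(1) show ?thesis by blast
qed

end

section \<open>Pointwise approximation and the dense conjugacy class\<close>

lemma in_closure_of_pointwise_topology:
  assumes "f \<in> carrier Isom" "C \<subseteq> carrier Isom"
    and "\<And>X \<epsilon>. finite X \<Longrightarrow> \<epsilon> > 0 \<Longrightarrow> \<exists>g\<in>C. \<forall>x\<in>X. dist (g x) (f x) < \<epsilon>"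
  shows "f \<in> pointwise_topology closure_of C"
  unfolding in_closure_of
proof (intro conjI allI impI)
  show "f \<in> topspace pointwise_topology" using assms(1) by simp
next
  fix S assume S: "f \<in> S \<and> openin pointwise_topology S"
  then obtain P where P: "openin (product_topology (\<lambda>_. euclidean) UNIV) P" "S = P \<inter> carrier Isom"
    by (auto simp: pointwise_topology_def openin_subtopology)
  then obtain U where U: "finite {x. U x \<noteq> UNIV}" "\<And>x. open (U x)" "f \<in> Pi\<^sub>E UNIV U" "Pi\<^sub>E UNIV U \<subseteq> P"
    using S by (auto simp: openin_product_topology_alt)
  let ?X = "{x. U x \<noteq> UNIV}"
  have "\<exists>\<delta>>0. ball (f x) \<delta> \<subseteq> U x" for x
    using U(2,3) by (meson PiE_mem UNIV_I open_contains_ball)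
  then obtain \<delta> where \<delta>: "\<And>x. \<delta> x > 0" "\<And>x. ball (f x) (\<delta> x) \<subseteq> U x" by metis
  \<comment> \<open>Only the finitely many restricted coordinates matter. The added 1 keeps the
    minimum well defined when there are none.\<close>
  define \<epsilon> where "\<epsilon> = Min (insert 1 (\<delta> ` ?X))"
  have "\<epsilon> > 0" "\<And>x. x \<in> ?X \<Longrightarrow> \<epsilon> \<le> \<delta> x"
    using U(1) \<delta>(1) by (auto simp: \<epsilon>_def)
  then obtain g where g: "g \<in> C" "\<And>x. x \<in> ?X \<Longrightarrow> dist (g x) (f x) < \<delta> x"
    using assms(3)[OF U(1)] by (meson order_less_le_trans)
  have "g x \<in> U x" for x
    using g(2)[of x] \<delta>(2)[of x] by (cases "U x = UNIV") (auto simp: dist_commute)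
  then have "g \<in> S" using U(4) P(2) g(1) assms(2) by auto
  then show "\<exists>y. y \<in> C \<and> y \<in> S" using g(1) by blast
qed

theorem theorem1p10:
  assumes "separable_space (euclidean :: 'a::{real_inner, complete_space} topology)"
    and "\<not> (\<exists>B :: 'a set. finite B \<and> span B = UNIV)"
  shows "\<exists>g \<in> carrier (Isom :: ('a \<Rightarrow> 'a) monoid).
    pointwise_topology closure_of conjugacy_class Isom g = carrier Isom"
proof -
  interpret group "Isom :: ('a \<Rightarrow> 'a) monoid" by (rule group_Isom)
  obtain T J :: "'a \<Rightarrow> 'a" where "bij T" and TJ: "wandering_shift T J"
    using wandering_shift_exists[OF assms] unfolding wandering_shift_def by blast
  interpret wandering_shift T J by (rule TJ)
  have T_dist: "dist (T x) (T y) = dist x y" for x y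
    by (simp add: dist_norm flip: linear_diff[OF lin_T])
  \<comment> \<open>\<open>almost_intertwining\<close> puts \<open>h x\<close> near
    \<open>T (h (f x))\<close>; applying the inverse of \<open>T\<close> puts \<open>g (h x)\<close>
    near \<open>h (f x)\<close>.\<close>
  define g where "g = inv\<^bsub>Isom\<^esub> T"
  have T_carrier: "T \<in> carrier Isom"
    using \<open>bij T\<close> T_dist by (simp add: Isom_def isometry_def)
  then have g: "g \<in> carrier Isom" unfolding g_def by (rule inv_closed)
  have "T \<circ> g = id"
    using r_inv[OF T_carrier] by (simp add: g_def Isom_def)
  then have Tg: "T (g x) = x" for x by (metis comp_apply id_apply)
  have sub: "conjugacy_class Isom g \<subseteq> carrier Isom"
    using g by (auto simp: conjugacy_class_def)
  have "f \<in> pointwise_topology closure_of conjugacy_class Isom g" if f: "f \<in> carrier Isom" for f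
  proof (rule in_closure_of_pointwise_topology[OF f sub])
    fix X :: "'a set" and \<epsilon> :: real
    assume "finite X" "\<epsilon> > 0"
    then obtain h where h: "isometry h" "\<And>x. x \<in> X \<Longrightarrow> dist (h x) (T (h (f x))) < \<epsilon>"
      using almost_intertwining[of f X \<epsilon>] f by (auto simp: Isom_def isometry_def)
    have hc: "h \<in> carrier Isom" using h(1) by (simp add: Isom_def)
    \<comment> \<open>Conjugating by the inverse \<open>k\<close> of \<open>h\<close> gives
      \<open>k \<circ> g \<circ> h\<close>, in the order required by
      \<open>conjugacy_class\<close>.\<close>
    define k where "k = inv\<^bsub>Isom\<^esub> h"
    have k: "k \<in> carrier Isom" unfolding k_def using hc by (rule inv_closed)
    have "h \<circ> k = id" using r_inv[OF hc] by (simp add: k_def Isom_def)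
    then have hk: "h (k x) = x" for x by (metis comp_apply id_apply)
    have "k \<otimes>\<^bsub>Isom\<^esub> g \<otimes>\<^bsub>Isom\<^esub> inv\<^bsub>Isom\<^esub> k \<in> conjugacy_class Isom g"
      using k by (auto simp: conjugacy_class_def)
    moreover have "k \<otimes>\<^bsub>Isom\<^esub> g \<otimes>\<^bsub>Isom\<^esub> inv\<^bsub>Isom\<^esub> k = k \<circ> g \<circ> h"
      using inv_inv[OF hc] by (simp add: k_def) (simp add: Isom_def)
    moreover have "dist ((k \<circ> g \<circ> h) x) (f x) < \<epsilon>" if "x \<in> X" for x
    proof -
      \<comment> \<open>Applying the isometry \<open>h\<close> cancels \<open>k\<close>, and then
        applying \<open>T\<close> cancels \<open>g\<close>, which leaves the distance already
        estimated.\<close>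
      have "dist ((k \<circ> g \<circ> h) x) (f x) = dist (h (k (g (h x)))) (h (f x))"
        using h(1) by (simp add: isometry_def)
      also have "\<dots> = dist (T (g (h x))) (T (h (f x)))"
        by (simp add: hk T_dist)
      finally show ?thesis using h(2)[OF that] by (simp add: Tg)
    qed
    ultimately show "\<exists>y\<in>conjugacy_class Isom g. \<forall>x\<in>X. dist (y x) (f x) < \<epsilon>" by metis
  qed
  moreover have "pointwise_topology closure_of conjugacy_class Isom g \<subseteq> carrier Isom"
    using closure_of_subset_topspace by fastforce
  ultimately show ?thesis using g by blast
qed

end
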